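(* Let $\kappa=(\{\kappa_n\},\{r_n\})$ be a measure of concordance. Suppose that $C$ is an $n$-copula, that $S$ and $T$ are disjoint subsets of $\overline n=\{1,\dots,n\}$, and that $s=\mathrm{card}(S)$ and $t=\mathrm{card}(T)$. Then $$r_{n-t}\,\kappa_{n-t}(\sigma_S^*(C_T))=\sum_{j=n-t-s}^{n-t}(-1)^{n-t-s+j}\,r_{n-t}r_{n-t-1}\cdots r_j\sum_{P\in S(n-t-j)}\kappa_j(C_{T+P}),$$ or, equivalently, $$\mathfrak A_{n-t}(\sigma_S^*(C_T))=\sum_{j=n-t-s}^{n-t}(-1)^{n-t-s+j}\,\mathfrak A_j^S(C_T).$$
   Context: Notation. $I=[0,1]$, $\overline{n}=\{1,\dots,n\}$, and $[0,x]=[0,x_1]\times\cdots\times[0,x_n]$ for $x\in I^n$. For $n\ge 1$ an $n$-copula is a function $C:I^n\to I$ for which there is a (necessarily unique) Borel probability measure $\mu_C$ on $I^n$ whose one-dimensional marginals are all Lebesgue measure on $I$ and which satisfies $\mu_C([0,x])=C(x)$. The unique 1-copula is $J(t)=t$; the unique 0-copula is the constant $1$. $M(t_1,\dots,t_n)=\min(t_1,\dots,t_n)$ and $\Pi(t_1,\dots,t_n)=t_1\cdots t_n$. Symmetries. A permutation of $I^n$ is a map $\tau(x_1,\dots,x_n)=(x_{\tau'(1)},\dots,x_{\tau'(n)})$, where $\tau'$ is a permutation of $\overline n$. The elementary reflection $\sigma_i$ of $I^n$ replaces $x_i$ by $1-x_i$ and fixes the other coordinates; for $S=\{i_1,\dots,i_k\}\subseteq\overline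 n$, $\sigma_S=\sigma_{i_1}\cdots\sigma_{i_k}$ (identity if $S=\emptyset$). $\mathcal{R}_n=\{\sigma_S:S\subseteq\overline n\}$ is the group of reflections and $\sigma=\sigma_{\overline n}$. For a permutation or reflection $\xi$ of $I^n$ and an $n$-copula $C$, $\xi^*(C)$ is the $n$-copula $[\xi^*(C)](x)=\mu_C(\xi([0,x]))$. For $n$-copulas $A,B$, $A\prec_{\mathcal C}B$ means $A\le B$ and $\sigma^*(A)\le\sigma^*(B)$ pointwise. Marginals. For an $n$-copula $C$ and $T\subseteq\overline n$ with $t=\mathrm{card}(T)$, $C_T:I^n\to I$ is the function obtained from $C$ by setting $x_i=1$ for all $i\in T$ (an extended marginal). Its proper copula is the $(n-t)$-copula obtained by regarding $C_T$ as a function of the remaining variables $x_i$, $i\notin T$, listed in increasing order of index; $\kappa_{n-t}(C_T)$ means $\kappa_{n-t}$ of this proper copula. There is a Borel measure $\mu_{C_T}$ on $I^n$ with $\mu_{C_T}([0,x])=C_T(x)$, and $[\sigma_S^*(C_T)](x)=\mu_{C_T}(\sigma_S([0,x]))$; for $S\cap T=\emptyset$ one has $\sigma_S^*(C_T)=(\sigma_S^*(C))_T$, an extended marginal of $\sigma_S^*(C)$, so $\kappa_{n-t}(\sigma_S^*(C_T))$ makes sense. A measure of concordance $\kappa=(\{\kappa_n\},\{r_n\})$ consists of maps $\kappa_n$ from the set of $n$-copulas to $\mathbb R$ and real numbers $r_n$, $n\ge2$, such that for all $n\ge2$ and all $n$-copulas $A,B,C,C_m$: A1 $\kappa_n(M)=1$,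 $\kappa_n(\Pi)=0$; A2 if $A\prec_{\mathcal C}B$ then $\kappa_n(A)\le\kappa_n(B)$; A3 if $C_m\to C$ uniformly then $\kappa_n(C_m)\to\kappa_n(C)$ as $m\to\infty$; A4 $\kappa_n(\tau^*(C))=\kappa_n(C)$ for every permutation $\tau$ of $I^n$; A5 $\kappa_n(\sigma^*(C))=\kappa_n(C)$; A6 $\sum_{\rho\in\mathcal R_n}\kappa_n(\rho^*(C))=0$; A7 $r_n\kappa_n(C)=\kappa_{n+1}(E)+\kappa_{n+1}(\sigma_1^*(E))$ whenever $E$ is an $(n+1)$-copula with $C(x_1,\dots,x_n)=E(1,x_1,\dots,x_n)$. One extends to $n=0,1$ by $\kappa_0=\kappa_1=0$; $r_0,r_1$ may be any real numbers. Set notation. $R+T$ denotes $R\cup T$ with the understanding that $R\cap T=\emptyset$. $S(k)$ is the set of subsets of $S$ of cardinality $k$ (empty if $k>\mathrm{card}(S)$). For a function $F=E_T$ that is an extended marginal of an $n$-copula $E$, with $t=\mathrm{card}(T)$, and for $S\subseteq\overline n$, $0\le j\le n$, $$\mathfrak A_j^S(E_T)=r_{n-t}r_{n-t-1}\cdots r_j\sum_{R\in(S\setminus T)(n-j-t)}\kappa_j(E_{R+T}),$$ taken to be $0$ if $(S\setminus T)(n-j-t)=\emptyset$; $\mathfrak A_j$ without superscript means $\mathfrak A_j^{\overline n}$. In particular $\mathfrak A_{n-t}(\sigma_S^*(C_T))$ is this expression with $E=\sigma_S^*(C)$. The product $r_{n-t}\cdots r_j$ has the single factor $r_{n-t}$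 when $j=n-t$. *)

theory Defs
  imports "HOL-Probability.Probability"
begin

text \<open>
  Points of $I^n$ are extensional functions on \<open>{1..n}\<close>, and real-valued functions on $I^n$
  are extensional on \<open>cube n\<close>, so that equality of HOL functions is equality on $I^n$.
\<close>

definition cube :: "nat \<Rightarrow> (nat \<Rightarrow> real) set" where
  "cube n = {1..n} \<rightarrow>\<^sub>E {0..1}"

definition lower_box :: "nat \<Rightarrow> (nat \<Rightarrow> real) \<Rightarrow> (nat \<Rightarrow> real) set" where
  "lower_box n x = (\<Pi>\<^sub>E i\<in>{1..n}. {0..x i})"

definition unit_borel :: "real measure" where
  "unit_borel = restrict_space borel {0..1}"

definition cube_borel :: "nat \<Rightarrow> (nat \<Rightarrow> real) measure" where
  "cube_borel n = (\<Pi>\<^sub>M i\<in>{1..n}. unit_borel)"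

definition represents :: "nat \<Rightarrow> (nat \<Rightarrow> real) measure \<Rightarrow> ((nat \<Rightarrow> real) \<Rightarrow> real) \<Rightarrow> bool" where
  "represents n \<mu> F \<longleftrightarrow> finite_measure \<mu> \<and> sets \<mu> = sets (cube_borel n) \<and>
     (\<forall>x\<in>cube n. measure \<mu> (lower_box n x) = F x)"

text \<open>For \<open>n = 0\<close> the following gives exactly the constant function 1 on the one-point cube.\<close>

definition copula :: "nat \<Rightarrow> ((nat \<Rightarrow> real) \<Rightarrow> real) \<Rightarrow> bool" where
  "copula n C \<longleftrightarrow> C \<in> cube n \<rightarrow>\<^sub>E {0..1} \<and>
     (\<exists>\<mu>. prob_space \<mu> \<and> represents n \<mu> C \<and>
       (\<forall>i\<in>{1..n}. distr \<mu> unit_borel (\<lambda>x. x i) = restrict_space lborel {0..1}))"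

text \<open>
  The lower boxes form an intersection-stable generator of the Borel sets of $I^n$ that contains
  $I^n$ itself, so there is at most one representing measure. No condition on marginals is
  imposed, because the measure is also needed for extended marginals of copulas.
\<close>

definition fun_measure :: "nat \<Rightarrow> ((nat \<Rightarrow> real) \<Rightarrow> real) \<Rightarrow> (nat \<Rightarrow> real) measure" where
  "fun_measure n F = (THE \<mu>. represents n \<mu> F)"

definition copula_M :: "nat \<Rightarrow> (nat \<Rightarrow> real) \<Rightarrow> real" where
  "copula_M n = (\<lambda>x\<in>cube n. Min (x ` {1..n}))"

definition copula_Pi :: "nat \<Rightarrow> (nat \<Rightarrow> real) \<Rightarrow> real" where
  "copula_Pi n = (\<lambda>x\<in>cube n. \<Prod>i\<in>{1..n}. x i)"

definition permutation_map :: "nat \<Rightarrow> (nat \<Rightarrow> nat) \<Rightarrow> (nat \<Rightarrow> real) \<Rightarrow> nat \<Rightarrow> real" where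
  "permutation_map n \<pi> x = (\<lambda>i\<in>{1..n}. x (\<pi> i))"

definition reflection :: "nat \<Rightarrow> nat set \<Rightarrow> (nat \<Rightarrow> real) \<Rightarrow> nat \<Rightarrow> real" where
  "reflection n S x = (\<lambda>i\<in>{1..n}. if i \<in> S then 1 - x i else x i)"

definition reflections :: "nat \<Rightarrow> ((nat \<Rightarrow> real) \<Rightarrow> nat \<Rightarrow> real) set" where
  "reflections n = reflection n ` Pow {1..n}"

text \<open>\<open>pull n \<xi> F\<close> is $\xi^*(F)$.\<close>

definition pull ::
  "nat \<Rightarrow> ((nat \<Rightarrow> real) \<Rightarrow> nat \<Rightarrow> real) \<Rightarrow> ((nat \<Rightarrow> real) \<Rightarrow> real) \<Rightarrow> (nat \<Rightarrow> real) \<Rightarrow> real" where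
  "pull n \<xi> F = (\<lambda>x\<in>cube n. measure (fun_measure n F) (\<xi> ` lower_box n x))"

definition concordance_le ::
  "nat \<Rightarrow> ((nat \<Rightarrow> real) \<Rightarrow> real) \<Rightarrow> ((nat \<Rightarrow> real) \<Rightarrow> real) \<Rightarrow> bool" where
  "concordance_le n A B \<longleftrightarrow>
     (\<forall>x\<in>cube n. A x \<le> B x) \<and>
     (\<forall>x\<in>cube n. pull n (reflection n {1..n}) A x \<le> pull n (reflection n {1..n}) B x)"

definition ext_marginal ::
  "nat \<Rightarrow> nat set \<Rightarrow> ((nat \<Rightarrow> real) \<Rightarrow> real) \<Rightarrow> (nat \<Rightarrow> real) \<Rightarrow> real" where
  "ext_marginal n T C = (\<lambda>x\<in>cube n. C (\<lambda>i\<in>{1..n}. if i \<in> T then 1 else x i))"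

text \<open>
  For \<open>i \<in> {1..n} - T\<close>, the number \<open>card ({1..i} - T)\<close> is the position of \<open>i\<close> in the increasing
  enumeration of \<open>{1..n} - T\<close>. The function \<open>F\<close> is meant to be independent of the coordinates in
  \<open>T\<close>; the value 1 given to them here is immaterial.
\<close>

definition proper_copula ::
  "nat \<Rightarrow> nat set \<Rightarrow> ((nat \<Rightarrow> real) \<Rightarrow> real) \<Rightarrow> (nat \<Rightarrow> real) \<Rightarrow> real" where
  "proper_copula n T F =
     (\<lambda>y\<in>cube (n - card T). F (\<lambda>i\<in>{1..n}. if i \<in> T then 1 else y (card ({1..i} - T))))"

locale measure_of_concordance =
  fixes \<kappa> :: "nat \<Rightarrow> ((nat \<Rightarrow> real) \<Rightarrow> real) \<Rightarrow> real"
    and r :: "nat \<Rightarrow> real"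
  assumes kappa_0: "copula 0 C \<Longrightarrow> \<kappa> 0 C = 0"
    and kappa_1: "copula 1 C \<Longrightarrow> \<kappa> 1 C = 0"
    and A1_M: "n \<ge> 2 \<Longrightarrow> \<kappa> n (copula_M n) = 1"
    and A1_Pi: "n \<ge> 2 \<Longrightarrow> \<kappa> n (copula_Pi n) = 0"
    and A2: "\<lbrakk>n \<ge> 2; copula n A; copula n B; concordance_le n A B\<rbrakk> \<Longrightarrow> \<kappa> n A \<le> \<kappa> n B"
    and A3: "\<lbrakk>n \<ge> 2; \<And>m. copula n (X m); copula n C; uniform_limit (cube n) X C sequentially\<rbrakk>
       \<Longrightarrow> (\<lambda>m. \<kappa> n (X m)) \<longlonglongrightarrow> \<kappa> n C"
    and A4: "\<lbrakk>n \<ge> 2; copula n C; \<pi> permutes {1..n}\<rbrakk>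
       \<Longrightarrow> \<kappa> n (pull n (permutation_map n \<pi>) C) = \<kappa> n C"
    and A5: "\<lbrakk>n \<ge> 2; copula n C\<rbrakk> \<Longrightarrow> \<kappa> n (pull n (reflection n {1..n}) C) = \<kappa> n C"
    and A6: "\<lbrakk>n \<ge> 2; copula n C\<rbrakk> \<Longrightarrow> (\<Sum>\<rho>\<in>reflections n. \<kappa> n (pull n \<rho> C)) = 0"
    and A7: "\<lbrakk>n \<ge> 2; copula n C; copula (n + 1) E;
        \<And>x. x \<in> cube n \<Longrightarrow> C x = E (\<lambda>i\<in>{1..n + 1}. if i = 1 then 1 else x (i - 1))\<rbrakk>
       \<Longrightarrow> r n * \<kappa> n C = \<kappa> (n + 1) E + \<kappa> (n + 1) (pull (n + 1) (reflection (n + 1) {1}) E)"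

text \<open>
  \<open>frakA \<kappa> r n S j T E\<close> is $\mathfrak{A}_j^S(E_T)$. The cardinality condition
  \<open>card R = n - j - card T\<close> is written without subtraction, so that no \<open>R\<close> qualifies (and the
  value is 0) when \<open>j > n - card T\<close>.
\<close>

definition frakA ::
  "(nat \<Rightarrow> ((nat \<Rightarrow> real) \<Rightarrow> real) \<Rightarrow> real) \<Rightarrow> (nat \<Rightarrow> real) \<Rightarrow> nat \<Rightarrow> nat set \<Rightarrow> nat \<Rightarrow> nat set
    \<Rightarrow> ((nat \<Rightarrow> real) \<Rightarrow> real) \<Rightarrow> real" where
  "frakA \<kappa> r n S j T E =
     (\<Prod>i = j..n - card T. r i) *
     (\<Sum>R | R \<subseteq> S - T \<and> card R + j + card T = n.
        \<kappa> j (proper_copula n (R \<union> T) (ext_marginal n (R \<union> T) E)))"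

end

theory Submission
  imports Defs
begin

text \<open>
  Axiom A7, moved to an arbitrary coordinate \<open>i\<close> by the permutation invariance A4, says that in
  dimension \<open>m\<close> reflecting \<open>i\<close> turns \<open>\<kappa>\<^sub>m\<close> into \<open>r\<^sub>m\<^sub>-\<^sub>1 \<kappa>\<^sub>m\<^sub>-\<^sub>1\<close> of the \<open>i\<close>-th marginal minus \<open>\<kappa>\<^sub>m\<close>
  itself. Removing the reflections in \<open>S\<close> one at a time therefore expands the left-hand side into
  an alternating sum over the subsets of \<open>S\<close>, which is then sorted by cardinality. All copulas
  occurring on the way are distribution functions of images of the one measure \<open>\<mu>\<^sub>C\<close>.
\<close>

section \<open>Borel sets of the cube and uniqueness of the representing measure\<close>

lemma space_unit_borel [simp]: "space unit_borel = {0..1}"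
  by (simp add: unit_borel_def space_restrict_space)

lemma space_cube_borel [simp]: "space (cube_borel n) = cube n"
  by (simp add: cube_borel_def cube_def space_PiM)

lemma Icc_in_sets_unit_borel: "a \<le> 1 \<Longrightarrow> {0..a} \<in> sets unit_borel"
  by (auto simp: unit_borel_def sets_restrict_space_iff)

lemma lower_box_in_sets: "x \<in> cube n \<Longrightarrow> lower_box n x \<in> sets (cube_borel n)"
  unfolding lower_box_def cube_borel_def
  by (rule sets_PiM_I_finite) (auto simp: cube_def PiE_iff intro!: Icc_in_sets_unit_borel)

text \<open>Half-lines are the generator of choice because nonempty products of their traces on
  \<open>{0..1}\<close> are lower boxes, the sets on which \<open>represents\<close> prescribes the
  measure.\<close>

lemma sets_unit_borel:
  "sets unit_borel = sigma_sets {0..1} ((\<inter>) {0..1} ` range atMost)"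
proof -
  have "sets (borel :: real measure) = sigma_sets UNIV (range atMost)"
    by (subst borel_eq_atMost) simp
  moreover have "{0..1::real} \<in> sigma_sets UNIV (range atMost)"
    using calculation by (metis atLeastAtMost_borel)
  ultimately show ?thesis
    unfolding unit_borel_def by (simp add: sets_restrict_space sigma_sets_Int)
qed

text \<open>The pi-lambda theorem for \<open>?E\<close>, the products of traces of half-lines:
  \<open>?E\<close> generates the Borel sets, is stable under intersection, contains the cube, and
  \<open>F\<close> determines both measures on it.\<close>

lemma represents_unique:
  assumes "represents n \<mu> F" "represents n \<nu> F"
  shows "\<mu> = \<nu>"
proof -
  interpret M: finite_measure \<mu> using assms by (simp add: represents_def)
  interpret N: finite_measure \<nu> using assms by (simp add: represents_def)
  let ?G = "(\<inter>) {0..1::real} ` range atMost"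
  let ?E = "{Pi\<^sub>E {1..n} B | B. \<forall>i\<in>{1..n}. B i \<in> ?G}"
  have gen: "sets (cube_borel n) = sigma_sets (cube n) ?E"
  proof -
    let ?P = "{{f \<in> {1..n} \<rightarrow>\<^sub>E {0..1}. \<forall>i\<in>j. f i \<in> A i} | A j. j \<in> {{1..n}} \<and> A \<in> j \<rightarrow> ?G}"
    have G: "?G \<subseteq> Pow {0..1}" by auto
    have top: "{0..1} \<in> ?G" by (auto simp: image_iff intro!: exI[of _ "1::real"])
    have PE: "?P = ?E"
    proof (intro equalityI subsetI)
      fix X assume "X \<in> ?P"
      then obtain A where A: "A \<in> {1..n} \<rightarrow> ?G"
        and X: "X = {f \<in> {1..n} \<rightarrow>\<^sub>E {0..1}. \<forall>i\<in>{1..n}. f i \<in> A i}" by auto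
      have "X = Pi\<^sub>E {1..n} A"
      proof -
        have "A i \<subseteq> {0..1}" if "i \<in> {1..n}" for i using A G that by blast
        then show ?thesis unfolding X by (blast intro: PiE_I dest: PiE_mem PiE_arb)
      qed
      then show "X \<in> ?E" using A by blast
    next
      fix X assume "X \<in> ?E"
      then obtain A where A: "\<forall>i\<in>{1..n}. A i \<in> ?G" and X: "X = Pi\<^sub>E {1..n} A" by blast
      have "X = {f \<in> {1..n} \<rightarrow>\<^sub>E {0..1}. \<forall>i\<in>{1..n}. f i \<in> A i}"
      proof -
        have "A i \<subseteq> {0..1}" if "i \<in> {1..n}" for i using A G that by blast
        then show ?thesis unfolding X by (blast intro: PiE_I dest: PiE_mem PiE_arb)
      qed
      then show "X \<in> ?P" using A by blast
    qed
    have "sets (cube_borel n) = sets (PiM {1..n} (\<lambda>_. sigma {0..1} ?G))"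
      unfolding cube_borel_def using sets_unit_borel G
      by (intro sets_PiM_cong) (auto simp: sets_measure_of)
    \<comment> \<open>The singleton \<open>{{0..1}}\<close> serves as the countable cover of each
      factor by generators.\<close>
    also have "\<dots> = sets (sigma ({1..n} \<rightarrow>\<^sub>E {0..1}) ?P)"
      by (rule sets_PiM_sigma) (use G top in \<open>auto intro!: exI[of _ "{{0..1}}"]\<close>)
    also have "\<dots> = sigma_sets (cube n) ?E"
      unfolding PE cube_def by (rule sets_measure_of) (auto simp: PiE_iff)
    finally show ?thesis .
  qed
  have eq: "emeasure \<mu> X = emeasure \<nu> X" if "X \<in> ?E" for X
  proof -
    from that obtain B where X: "X = Pi\<^sub>E {1..n} B" and B: "\<forall>i\<in>{1..n}. B i \<in> ?G"
      by auto
    then have "\<forall>i\<in>{1..n}. \<exists>a. B i = {0..1} \<inter> {..a}" by blast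
    then obtain a where a: "\<forall>i\<in>{1..n}. B i = {0..1} \<inter> {..a i}" by metis
    \<comment> \<open>A negative bound makes the product empty. Otherwise cutting all bounds down to
      at most 1 gives a corner inside the cube, so the product is a lower box.\<close>
    show ?thesis
    proof (cases "\<exists>i\<in>{1..n}. a i < 0")
      case True
      then have "X = {}" using a by (force simp: X PiE_eq_empty_iff)
      then show ?thesis by simp
    next
      case False
      define x where "x = (\<lambda>i\<in>{1..n}. min 1 (a i))"
      have x: "x \<in> cube n" using False by (auto simp: cube_def x_def not_less)
      have "X = lower_box n x"
        unfolding X lower_box_def using a by (intro PiE_cong) (auto simp: x_def)
      with x show ?thesis
        using assms by (simp add: represents_def M.emeasure_eq_measure N.emeasure_eq_measure)
    qed
  qed
  show ?thesis
  proof (rule measure_eqI_generator_eq[where E="?E" and \<Omega>="cube n" and A="\<lambda>_. cube n"])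
    show "Int_stable ?E"
    proof (rule Int_stableI)
      fix X Y assume "X \<in> ?E" "Y \<in> ?E"
      then obtain B D where BD: "X = Pi\<^sub>E {1..n} B" "\<forall>i\<in>{1..n}. B i \<in> ?G"
        "Y = Pi\<^sub>E {1..n} D" "\<forall>i\<in>{1..n}. D i \<in> ?G"
        by blast
      have UV: "U \<inter> V \<in> ?G" if "U \<in> ?G" "V \<in> ?G" for U V
      proof -
        from that obtain u v where "U = {0..1} \<inter> {..u}" "V = {0..1} \<inter> {..v}" by blast
        then have "U \<inter> V = {0..1} \<inter> {..min u v}" by auto
        then show ?thesis by blast
      qed
      have "\<forall>i\<in>{1..n}. B i \<inter> D i \<in> ?G"
        using BD(2,4) by (intro ballI) (rule UV; erule bspec)
      moreover have "X \<inter> Y = (\<Pi>\<^sub>E i\<in>{1..n}. B i \<inter> D i)" unfolding BD(1,3) by (rule PiE_Int)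
      ultimately show "X \<inter> Y \<in> ?E" by blast
    qed
    show "?E \<subseteq> Pow (cube n)"
      by (auto simp: cube_def PiE_iff)
    have "cube n = Pi\<^sub>E {1..n} (\<lambda>_. {0..1} \<inter> {..1})"
      unfolding cube_def by (intro PiE_cong) auto
    moreover have "{0..1::real} \<inter> {..1} \<in> ?G" by blast
    ultimately show "range (\<lambda>_. cube n) \<subseteq> ?E" by blast
    show "sets \<mu> = sigma_sets (cube n) ?E" "sets \<nu> = sigma_sets (cube n) ?E"
      unfolding gen[symmetric] using assms by (simp_all add: represents_def)
    show "emeasure \<mu> X = emeasure \<nu> X" if "X \<in> ?E" for X
      using that by (rule eq)
  qed simp_all
qed

lemma fun_measure_eq: "represents n \<mu> F \<Longrightarrow> fun_measure n F = \<mu>"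
  unfolding fun_measure_def by (rule the_equality) (simp_all add: represents_unique)

section \<open>Copulas as distribution functions of measures with uniform marginals\<close>

definition copula_measure :: "nat \<Rightarrow> (nat \<Rightarrow> real) measure \<Rightarrow> bool" where
  "copula_measure n \<mu> \<longleftrightarrow> prob_space \<mu> \<and> sets \<mu> = sets (cube_borel n) \<and>
     (\<forall>i\<in>{1..n}. distr \<mu> unit_borel (\<lambda>x. x i) = restrict_space lborel {0..1})"

text \<open>Extensional on the cube, as \<open>copula\<close> demands, so that a copula and the
  \<open>cdf_of\<close> of its measure are equal as HOL functions.\<close>

definition cdf_of :: "nat \<Rightarrow> (nat \<Rightarrow> real) measure \<Rightarrow> (nat \<Rightarrow> real) \<Rightarrow> real" where
  "cdf_of n \<mu> = (\<lambda>x\<in>cube n. measure \<mu> (lower_box n x))"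

lemma represents_cdf_of:
  "\<lbrakk>finite_measure \<mu>; sets \<mu> = sets (cube_borel n)\<rbrakk> \<Longrightarrow> represents n \<mu> (cdf_of n \<mu>)"
  by (simp add: represents_def cdf_of_def)

lemma copula_cdf_of:
  assumes "copula_measure n \<mu>"
  shows "copula n (cdf_of n \<mu>)"
proof -
  interpret prob_space \<mu> using assms by (simp add: copula_measure_def)
  show ?thesis
    unfolding copula_def
  proof (intro conjI exI[of _ \<mu>])
    show "represents n \<mu> (cdf_of n \<mu>)"
      using assms by (intro represents_cdf_of) (auto simp: copula_measure_def finite_measure_axioms)
    show "cdf_of n \<mu> \<in> cube n \<rightarrow>\<^sub>E {0..1}"
      by (simp add: cdf_of_def)
  qed (use assms in \<open>simp_all add: copula_measure_def\<close>)
qed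

lemma copulaE:
  assumes "copula n C"
  obtains \<mu> where "copula_measure n \<mu>" "C = cdf_of n \<mu>"
proof -
  from assms obtain \<mu> where \<mu>: "prob_space \<mu>" "represents n \<mu> C"
    "\<forall>i\<in>{1..n}. distr \<mu> unit_borel (\<lambda>x. x i) = restrict_space lborel {0..1}"
    and C: "C \<in> cube n \<rightarrow>\<^sub>E {0..1}"
    unfolding copula_def by blast
  have "C = cdf_of n \<mu>"
  proof (rule ext)
    fix x show "C x = cdf_of n \<mu> x"
      using \<mu>(2) PiE_arb[OF C] by (cases "x \<in> cube n") (simp_all add: represents_def cdf_of_def)
  qed
  with \<mu> show ?thesis by (intro that) (auto simp: copula_measure_def represents_def)
qed

section \<open>Rearranging and reflecting coordinates of a measure\<close>

text \<open>Reflections, permutations and the coordinate projections that define proper marginals are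
  all of this form: read coordinate \<open>e k\<close> into place \<open>k\<close>, after reflecting it if \<open>e k \<in> S\<close>.\<close>

definition rearrange :: "nat \<Rightarrow> (nat \<Rightarrow> nat) \<Rightarrow> nat set \<Rightarrow> (nat \<Rightarrow> real) \<Rightarrow> nat \<Rightarrow> real" where
  "rearrange m e S x = (\<lambda>k\<in>{1..m}. if e k \<in> S then 1 - x (e k) else x (e k))"

lemma reflection_eq_rearrange: "reflection n S = rearrange n (\<lambda>k. k) S"
  by (simp add: reflection_def rearrange_def fun_eq_iff)

lemma permutation_map_eq_rearrange: "permutation_map n \<pi> = rearrange n \<pi> {}"
  by (simp add: permutation_map_def rearrange_def fun_eq_iff)

lemma rearrange_in_cube: "\<lbrakk>x \<in> cube n; e ` {1..m} \<subseteq> {1..n}\<rbrakk> \<Longrightarrow> rearrange m e S x \<in> cube m"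
  by (auto simp: rearrange_def cube_def PiE_iff image_subset_iff)

lemma one_minus_measurable: "(\<lambda>x. 1 - x) \<in> unit_borel \<rightarrow>\<^sub>M unit_borel"
  unfolding unit_borel_def
  by (rule measurable_restrict_space3) auto

lemma rearrange_measurable:
  assumes "e ` {1..m} \<subseteq> {1..n}"
  shows "rearrange m e S \<in> cube_borel n \<rightarrow>\<^sub>M cube_borel m"
  unfolding cube_borel_def rearrange_def
proof (rule measurable_restrict)
  fix k assume "k \<in> {1..m}"
  with assms have k: "e k \<in> {1..n}" by (simp add: image_subset_iff)
  have *: "(\<lambda>x. x (e k)) \<in> (\<Pi>\<^sub>M i\<in>{1..n}. unit_borel) \<rightarrow>\<^sub>M unit_borel"
    by (rule measurable_component_singleton[OF k])
  show "(\<lambda>x. if e k \<in> S then 1 - x (e k) else x (e k)) \<in> (\<Pi>\<^sub>M i\<in>{1..n}. unit_borel) \<rightarrow>\<^sub>M unit_borel"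
    using * measurable_compose[OF * one_minus_measurable] by (cases "e k \<in> S") simp_all
qed

text \<open>Lebesgue measure is invariant under the affine map with slope -1 and offset 1, and this
  map carries the unit interval onto itself.\<close>

lemma distr_one_minus_uniform:
  "distr (restrict_space lborel {0..1}) unit_borel (\<lambda>x. 1 - x) = restrict_space lborel {0..1::real}"
proof (rule measure_eqI)
  show "sets (distr (restrict_space lborel {0..1}) unit_borel (\<lambda>x. 1 - x))
      = sets (restrict_space lborel {0..1::real})"
    by (simp add: unit_borel_def sets_restrict_space)
  fix A assume "A \<in> sets (distr (restrict_space lborel {0..1}) unit_borel (\<lambda>x::real. 1 - x))"
  then have A: "A \<in> sets borel" "A \<subseteq> {0..1}" and A': "A \<in> sets unit_borel"
    by (auto simp: unit_borel_def sets_restrict_space_iff)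
  have m: "(\<lambda>x. 1 - x) \<in> restrict_space lborel {0..1::real} \<rightarrow>\<^sub>M unit_borel"
    unfolding unit_borel_def by (rule measurable_restrict_space3) auto
  have "emeasure lborel A = emeasure (distr lborel borel (\<lambda>x. 1 - x)) A"
    using lborel_real_affine[of "-1" 1] A by (simp add: density_1)
  also have "\<dots> = emeasure lborel ((\<lambda>x. 1 - x) -` A)"
    using A by (simp add: emeasure_distr)
  finally have "emeasure lborel ((\<lambda>x. 1 - x) -` A) = emeasure lborel A" by simp
  moreover have "(\<lambda>x. 1 - x) -` A \<subseteq> {0..1}" using A by auto
  ultimately show "emeasure (distr (restrict_space lborel {0..1}) unit_borel (\<lambda>x. 1 - x)) A
      = emeasure (restrict_space lborel {0..1}) A"
    using A A' m by (simp add: Int_absorb2 emeasure_distr emeasure_restrict_space space_restrict_space)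
qed

definition rearranged ::
  "nat \<Rightarrow> (nat \<Rightarrow> nat) \<Rightarrow> nat set \<Rightarrow> (nat \<Rightarrow> real) measure \<Rightarrow> (nat \<Rightarrow> real) measure" where
  "rearranged m e S \<mu> = distr \<mu> (cube_borel m) (rearrange m e S)"

text \<open>Coordinate \<open>k\<close> of the image is coordinate \<open>e k\<close> of the
  original or its reflection, and both are uniformly distributed.\<close>

lemma copula_measure_rearranged:
  assumes \<mu>: "copula_measure n \<mu>" and e: "e ` {1..m} \<subseteq> {1..n}"
  shows "copula_measure m (rearranged m e S \<mu>)"
proof -
  interpret prob_space \<mu> using \<mu> by (simp add: copula_measure_def)
  have sets: "sets \<mu> = sets (cube_borel n)" using \<mu> by (simp add: copula_measure_def)
  have meas: "rearrange m e S \<in> \<mu> \<rightarrow>\<^sub>M cube_borel m"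
    using rearrange_measurable[OF e] measurable_cong_sets[OF sets refl] by blast
  have "distr (rearranged m e S \<mu>) unit_borel (\<lambda>x. x k) = restrict_space lborel {0..1}"
    if k: "k \<in> {1..m}" for k
  proof -
    have comp: "(\<lambda>x. x i) \<in> cube_borel p \<rightarrow>\<^sub>M unit_borel" if "i \<in> {1..p}" for i p
      unfolding cube_borel_def by (rule measurable_component_singleton[OF that])
    have ek: "e k \<in> {1..n}" using e k by (simp add: image_subset_iff)
    have comp': "(\<lambda>x. x (e k)) \<in> \<mu> \<rightarrow>\<^sub>M unit_borel"
      using comp[OF ek] measurable_cong_sets[OF sets refl] by blast
    have "distr (rearranged m e S \<mu>) unit_borel (\<lambda>x. x k)
        = distr \<mu> unit_borel (\<lambda>x. if e k \<in> S then 1 - x (e k) else x (e k))"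
      unfolding rearranged_def distr_distr[OF comp[OF k] meas] comp_def
      using k by (simp add: rearrange_def)
    moreover have *: "distr \<mu> unit_borel (\<lambda>x. x (e k)) = restrict_space lborel {0..1}"
      using \<mu> ek by (simp add: copula_measure_def)
    moreover have "distr \<mu> unit_borel (\<lambda>x. 1 - x (e k)) = restrict_space lborel {0..1}"
      using distr_distr[OF one_minus_measurable comp'] distr_one_minus_uniform
      by (simp add: * comp_def)
    ultimately show ?thesis by (cases "e k \<in> S") simp_all
  qed
  then show ?thesis
    unfolding copula_measure_def by (auto simp: rearranged_def prob_space_distr[OF meas])
qed

text \<open>Within the cube the bounds from below hold by themselves, so only the upper inequalities
  remain. Distribution functions of different dimensions can then be compared through subsets of the
  one space \<open>cube n\<close>.\<close>

lemma measure_rearranged_lower_box: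
  assumes sets: "sets \<mu> = sets (cube_borel n)" and e: "e ` {1..m} \<subseteq> {1..n}" and y: "y \<in> cube m"
  shows "measure (rearranged m e S \<mu>) (lower_box m y) =
    measure \<mu> {x \<in> cube n. \<forall>k\<in>{1..m}. rearrange m e S x k \<le> y k}"
proof -
  have meas: "rearrange m e S \<in> \<mu> \<rightarrow>\<^sub>M cube_borel m"
    using rearrange_measurable[OF e] measurable_cong_sets[OF sets refl] by blast
  have "rearrange m e S x \<in> lower_box m y \<longleftrightarrow> (\<forall>k\<in>{1..m}. rearrange m e S x k \<le> y k)"
    if "x \<in> cube n" for x
  proof -
    have "\<forall>k\<in>{1..m}. 0 \<le> rearrange m e S x k" "rearrange m e S x \<in> extensional {1..m}"
      using rearrange_in_cube[OF that e, of S] by (auto simp: cube_def PiE_iff)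
    then show ?thesis by (auto simp: lower_box_def PiE_iff)
  qed
  then have "rearrange m e S -` lower_box m y \<inter> space \<mu> =
     {x \<in> cube n. \<forall>k\<in>{1..m}. rearrange m e S x k \<le> y k}"
    using sets_eq_imp_space_eq[OF sets] by auto
  then show ?thesis
    unfolding rearranged_def using meas y by (simp add: measure_distr lower_box_in_sets)
qed

lemma rearranged_cong:
  assumes sets: "sets \<mu> = sets (cube_borel n)"
    and "\<And>x. x \<in> cube n \<Longrightarrow> rearrange m e S x = rearrange m e' S' x"
  shows "rearranged m e S \<mu> = rearranged m e' S' \<mu>"
  unfolding rearranged_def using assms sets_eq_imp_space_eq[OF sets]
  by (intro distr_cong) auto

text \<open>Reflecting a coordinate twice restores it, whence the exclusive or. \<open>S\<close> and
  \<open>S'\<close> refer to coordinates of the original cube, \<open>Q\<close> to positions in the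
  intermediate one.\<close>

lemma rearranged_rearranged:
  assumes sets: "sets \<mu> = sets (cube_borel n)"
    and e: "e ` {1..m} \<subseteq> {1..n}" and f: "f ` {1..l} \<subseteq> {1..m}"
    and S: "\<And>k. k \<in> {1..l} \<Longrightarrow> e (f k) \<in> S' \<longleftrightarrow> (e (f k) \<in> S) \<noteq> (f k \<in> Q)"
  shows "rearranged l f Q (rearranged m e S \<mu>) = rearranged l (e \<circ> f) S' \<mu>"
proof -
  have meas: "rearrange m e S \<in> \<mu> \<rightarrow>\<^sub>M cube_borel m"
    using rearrange_measurable[OF e] measurable_cong_sets[OF sets refl] by blast
  have "rearrange l f Q \<circ> rearrange m e S = rearrange l (e \<circ> f) S'"
    using f S by (fastforce simp: rearrange_def fun_eq_iff image_subset_iff)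
  then show ?thesis
    unfolding rearranged_def by (simp add: distr_distr[OF rearrange_measurable[OF f] meas])
qed

lemma rearranged_id:
  assumes sets: "sets \<mu> = sets (cube_borel n)"
  shows "rearranged n (\<lambda>k. k) {} \<mu> = \<mu>"
proof -
  have "rearranged n (\<lambda>k. k) {} \<mu> = distr \<mu> \<mu> (\<lambda>x. x)"
    unfolding rearranged_def
    using sets sets_eq_imp_space_eq[OF sets]
    by (intro distr_cong) (auto simp: rearrange_def cube_def PiE_iff extensional_def)
  then show ?thesis by (simp add: distr_id)
qed

section \<open>Pullbacks along reflections and permutations\<close>

text \<open>A pullback measures direct images of boxes, an image measure uses preimages, so the
  inverse map has to appear. It reads place \<open>inv e k\<close> into place \<open>k\<close> and
  reflects exactly if \<open>k\<close> lies in \<open>S\<close>.\<close>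

lemma pull_rearrange:
  assumes rep: "represents n \<mu> F" and e: "e permutes {1..n}"
  shows "pull n (rearrange n e S) F = cdf_of n (rearranged n (inv e) (inv e ` S) \<mu>)"
proof -
  let ?f = "rearrange n e S" and ?g = "rearrange n (inv e) (inv e ` S)"
  have sets: "sets \<mu> = sets (cube_borel n)" using rep by (simp add: represents_def)
  have im: "e ` {1..n} \<subseteq> {1..n}" "inv e ` {1..n} \<subseteq> {1..n}"
    using permutes_image[OF e] permutes_image[OF permutes_inv[OF e]] by auto
  have S: "inv e k \<in> inv e ` S \<longleftrightarrow> k \<in> S" for k
    using permutes_inv[OF e] by (simp add: inj_image_mem_iff permutes_inj)
  have gf: "?g (?f x) = x" and fg: "?f (?g x) = x" if x: "x \<in> cube n" for x
  proof -
    have undef: "x k = undefined" if "k \<notin> {1..n}" for k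
      using x that by (auto simp: cube_def PiE_iff extensional_def)
    have k: "e k \<in> {1..n}" "inv e k \<in> {1..n}" if "k \<in> {1..n}" for k
      using im that by (auto simp: image_subset_iff simp del: atLeastAtMost_iff)
    show "?g (?f x) = x"
    proof
      fix i show "?g (?f x) i = x i"
        using k[of i] undef[of i] S[of i] permutes_inverses[OF e]
        by (cases "i \<in> {1..n}") (simp_all add: rearrange_def del: atLeastAtMost_iff)
    qed
    show "?f (?g x) = x"
    proof
      fix i show "?f (?g x) i = x i"
        using k[of i] undef[of i] S[of "e i"] permutes_inverses[OF e]
        by (cases "i \<in> {1..n}") (simp_all add: rearrange_def del: atLeastAtMost_iff)
    qed
  qed
  have meas: "?g \<in> \<mu> \<rightarrow>\<^sub>M cube_borel n"
    using rearrange_measurable[OF im(2)] measurable_cong_sets[OF sets refl] by blast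
  have "?f ` lower_box n x = ?g -` lower_box n x \<inter> space \<mu>" if x: "x \<in> cube n" for x
  proof -
    have "lower_box n x \<subseteq> cube n" using sets.sets_into_space[OF lower_box_in_sets[OF x]] by simp
    then have "?f ` lower_box n x = ?g -` lower_box n x \<inter> cube n"
      using gf fg rearrange_in_cube[OF _ im(1), of _ S]
      by (auto simp: image_iff subset_iff) metis
    then show ?thesis
      using sets_eq_imp_space_eq[OF sets] by simp
  qed
  then show ?thesis
    unfolding pull_def cdf_of_def fun_measure_eq[OF rep] rearranged_def
    using meas by (auto simp: measure_distr lower_box_in_sets restrict_def)
qed

lemma pull_reflection:
  assumes "represents n \<mu> F"
  shows "pull n (reflection n S) F = cdf_of n (rearranged n (\<lambda>k. k) S \<mu>)"
proof -
  have "(\<lambda>k. k) permutes {1..n}" using permutes_id by (simp add: id_def)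
  moreover have "inv (\<lambda>k::nat. k) = (\<lambda>k. k)" using inv_id by (simp add: id_def)
  ultimately show ?thesis
    using pull_rearrange[OF assms] by (simp add: reflection_eq_rearrange)
qed

lemma copula_measure_represents:
  "copula_measure n \<mu> \<Longrightarrow> represents n \<mu> (cdf_of n \<mu>)"
  by (auto simp: copula_measure_def prob_space_def intro!: represents_cdf_of)

lemma pull_reflection_rearranged:
  assumes \<mu>: "copula_measure n \<mu>" and e: "e ` {1..m} \<subseteq> {1..n}"
    and S: "\<And>k. k \<in> {1..m} \<Longrightarrow> e k \<in> S' \<longleftrightarrow> (e k \<in> S) \<noteq> (k \<in> Q)"
  shows "pull m (reflection m Q) (cdf_of m (rearranged m e S \<mu>)) = cdf_of m (rearranged m e S' \<mu>)"
proof -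
  have sets: "sets \<mu> = sets (cube_borel n)" using \<mu> by (simp add: copula_measure_def)
  have "rearranged m (\<lambda>k. k) Q (rearranged m e S \<mu>) = rearranged m (e \<circ> (\<lambda>k. k)) S' \<mu>"
    by (rule rearranged_rearranged[OF sets e]) (use S in auto)
  then show ?thesis
    using pull_reflection[OF copula_measure_represents[OF copula_measure_rearranged[OF \<mu> e]]]
    by (simp add: comp_def)
qed

text \<open>Pulling back inverts the permutation, so starting from \<open>inv \<pi>\<close> puts
  \<open>\<pi>\<close> itself into the composition.\<close>

lemma pull_permutation_map_rearranged:
  assumes \<mu>: "copula_measure n \<mu>" and e: "e ` {1..m} \<subseteq> {1..n}" and p: "\<pi> permutes {1..m}"
  shows "pull m (permutation_map m (inv \<pi>)) (cdf_of m (rearranged m e S \<mu>))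
    = cdf_of m (rearranged m (e \<circ> \<pi>) S \<mu>)"
proof -
  have sets: "sets \<mu> = sets (cube_borel n)" using \<mu> by (simp add: copula_measure_def)
  have "rearranged m \<pi> {} (rearranged m e S \<mu>) = rearranged m (e \<circ> \<pi>) S \<mu>"
    by (rule rearranged_rearranged[OF sets e]) (use permutes_image[OF p] in auto)
  then show ?thesis
    using pull_rearrange[OF copula_measure_represents[OF copula_measure_rearranged[OF \<mu> e]]
        permutes_inv[OF p]]
    by (simp add: permutation_map_eq_rearrange permutes_inv_inv[OF p])
qed

section \<open>Consequences of the axioms for rearranged copulas\<close>

context measure_of_concordance
begin

text \<open>With the measure kept fixed, a value of \<open>\<kappa>\<close> depends only on which
  coordinates are kept, in which order, and which of them are reflected.\<close>

definition kappa_rearranged ::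
  "(nat \<Rightarrow> real) measure \<Rightarrow> nat \<Rightarrow> (nat \<Rightarrow> nat) \<Rightarrow> nat set \<Rightarrow> real" where
  "kappa_rearranged \<mu> m e S = \<kappa> m (cdf_of m (rearranged m e S \<mu>))"

lemma kappa_rearranged_less_2:
  assumes "copula_measure n \<mu>" "e ` {1..m} \<subseteq> {1..n}" "m < 2"
  shows "kappa_rearranged \<mu> m e S = 0"
proof -
  have "copula m (cdf_of m (rearranged m e S \<mu>))"
    using assms by (intro copula_cdf_of copula_measure_rearranged)
  moreover have "m = 0 \<or> m = 1" using assms by auto
  ultimately show ?thesis unfolding kappa_rearranged_def using kappa_0 kappa_1 by auto
qed

lemma kappa_rearranged_cong:
  assumes "copula_measure n \<mu>"
    and "\<And>k. k \<in> {1..m} \<Longrightarrow> e k = e' k" "\<And>k. k \<in> {1..m} \<Longrightarrow> e k \<in> S \<longleftrightarrow> e k \<in> S'"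
  shows "kappa_rearranged \<mu> m e S = kappa_rearranged \<mu> m e' S'"
proof -
  have "rearranged m e S \<mu> = rearranged m e' S' \<mu>"
    using assms by (intro rearranged_cong[where n=n])
      (auto simp: copula_measure_def rearrange_def fun_eq_iff)
  then show ?thesis by (simp add: kappa_rearranged_def)
qed

text \<open>Two enumerations of the same coordinates differ by a permutation of the positions, which
  A4 ignores. In dimensions 0 and 1 both values vanish.\<close>

lemma kappa_rearranged_image_cong:
  assumes \<mu>: "copula_measure n \<mu>" and U: "U \<subseteq> {1..n}"
    and e: "bij_betw e {1..m} U" and e': "bij_betw e' {1..m} U"
  shows "kappa_rearranged \<mu> m e S = kappa_rearranged \<mu> m e' S"
proof -
  have im: "e ` {1..m} \<subseteq> {1..n}" "e' ` {1..m} \<subseteq> {1..n}"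
    using U e e' by (simp_all add: bij_betw_def)
  show ?thesis
  proof (cases "m < 2")
    case True
    then show ?thesis using kappa_rearranged_less_2[OF \<mu>] im by simp
  next
    case False
    \<comment> \<open>This is \<open>e\<close> inverted after \<open>e'\<close>, continued by the
      identity because \<open>permutes\<close> demands it.\<close>
    define \<pi> where "\<pi> = (\<lambda>k. if k \<in> {1..m} then inv_into {1..m} e (e' k) else k)"
    have "bij_betw (inv_into {1..m} e \<circ> e') {1..m} {1..m}"
      using e' bij_betw_inv_into[OF e] by (rule bij_betw_trans)
    then have "bij_betw \<pi> {1..m} {1..m}"
      by (rule iffD1[OF bij_betw_cong, rotated]) (simp add: \<pi>_def)
    then have p: "\<pi> permutes {1..m}"
      by (rule bij_imp_permutes) (auto simp: \<pi>_def)
    have "(e \<circ> \<pi>) k = e' k" if "k \<in> {1..m}" for k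
    proof -
      have "e' k \<in> U" using e' that by (auto simp: bij_betw_def)
      then show ?thesis using that e by (simp add: \<pi>_def bij_betw_inv_into_right)
    qed
    then have "kappa_rearranged \<mu> m (e \<circ> \<pi>) S = kappa_rearranged \<mu> m e' S"
      by (intro kappa_rearranged_cong[OF \<mu>]) auto
    moreover have "kappa_rearranged \<mu> m (e \<circ> \<pi>) S = kappa_rearranged \<mu> m e S"
      unfolding kappa_rearranged_def
        pull_permutation_map_rearranged[OF \<mu> im(1) p, symmetric]
      using False by (intro A4 copula_cdf_of copula_measure_rearranged[OF \<mu> im(1)] permutes_inv p) auto
    ultimately show ?thesis by simp
  qed
qed

text \<open>In dimension 2 the identity of axiom A7 holds because A6 sums over four reflections which A5
  identifies in pairs.\<close>

lemma kappa_2_reflection: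
  assumes \<mu>: "copula_measure 2 \<mu>"
  shows "\<kappa> 2 (cdf_of 2 \<mu>) + \<kappa> 2 (pull 2 (reflection 2 {1}) (cdf_of 2 \<mu>)) = 0"
proof -
  define k where "k Q = \<kappa> 2 (pull 2 (reflection 2 Q) (cdf_of 2 \<mu>))" for Q
  have sets: "sets \<mu> = sets (cube_borel 2)" using \<mu> by (simp add: copula_measure_def)
  have k: "k Q = \<kappa> 2 (cdf_of 2 (rearranged 2 (\<lambda>k. k) Q \<mu>))" for Q
    by (simp add: k_def pull_reflection[OF copula_measure_represents[OF \<mu>]])
  \<comment> \<open>Reflecting all coordinates on top of \<open>Q\<close> leaves exactly the
    complement of \<open>Q\<close> reflected, and A5 identifies the two values.\<close>
  have compl: "k ({1..2} - Q) = k Q" for Q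
  proof -
    have "pull 2 (reflection 2 {1..2}) (cdf_of 2 (rearranged 2 (\<lambda>k. k) Q \<mu>)) =
      cdf_of 2 (rearranged 2 (\<lambda>k. k) ({1..2} - Q) \<mu>)"
      by (rule pull_reflection_rearranged[OF \<mu>]) auto
    moreover have "copula 2 (cdf_of 2 (rearranged 2 (\<lambda>k. k) Q \<mu>))"
      by (intro copula_cdf_of copula_measure_rearranged[OF \<mu>]) auto
    ultimately show ?thesis using A5 unfolding k by fastforce
  qed
  \<comment> \<open>A6 sums over a set of maps; injectivity makes each subset count once. The origin
    tells reflections apart, since its image is 1 exactly in the reflected coordinates.\<close>
  have inj: "inj_on (reflection 2) (Pow {1..2})"
  proof (rule inj_onI)
    fix P Q assume PQ: "P \<in> Pow {1..2}" "Q \<in> Pow {1..2}" "reflection 2 P = reflection 2 Q"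
    have "i \<in> P \<longleftrightarrow> i \<in> Q" if "i \<in> {1..2}" for i
      using fun_cong[OF fun_cong[OF PQ(3), of "\<lambda>_. 0"], of i] that
      by (auto simp: reflection_def split: if_splits)
    then show "P = Q" using PQ by blast
  qed
  have "{1..2::nat} = {1, 2}" by auto
  then have pow: "Pow {1..2::nat} = {{}, {1}, {2}, {1, 2}}"
    by (auto simp: Pow_insert)
  have "0 = (\<Sum>Q\<in>Pow {1..2}. k Q)"
    using A6[OF _ copula_cdf_of[OF \<mu>]]
    unfolding reflections_def sum.reindex[OF inj] by (simp add: k_def comp_def)
  also have "\<dots> = k {} + k {1} + k {2} + k {1, 2}"
    unfolding pow by (subst sum.insert, simp, simp)+ simp
  also have "k {2} = k {1}"
  proof -
    have "{1..2::nat} - {1} = {2}" by auto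
    with compl[of "{1}"] show ?thesis by (simp only:)
  qed
  also have "k {1, 2} = k {}"
  proof -
    have "{1..2::nat} - {} = {1, 2}" by auto
    with compl[of "{}"] show ?thesis by (simp only:)
  qed
  finally have "k {} + k {1} = 0" by simp
  moreover have "k {} = \<kappa> 2 (cdf_of 2 \<mu>)"
    by (simp add: k rearranged_id[OF sets])
  ultimately show ?thesis by (simp add: k_def)
qed

text \<open>Setting the first coordinate to 1 drops position 1, which leaves the enumeration
  \<open>e \<circ> Suc\<close>; \<open>S'\<close> toggles the reflection at that position alone. A7
  covers \<open>m \<ge> 2\<close>. For \<open>m = 0\<close> all terms vanish, and for
  \<open>m = 1\<close> the identity in dimension 2 takes its place.\<close>

lemma kappa_rearranged_A7:
  assumes \<mu>: "copula_measure n \<mu>" and e: "e ` {1..Suc m} \<subseteq> {1..n}"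
    and S': "\<And>k. k \<in> {1..Suc m} \<Longrightarrow> e k \<in> S' \<longleftrightarrow> (e k \<in> S) \<noteq> (k = 1)"
  shows "r m * kappa_rearranged \<mu> m (e \<circ> Suc) S =
    kappa_rearranged \<mu> (Suc m) e S + kappa_rearranged \<mu> (Suc m) e S'"
proof -
  let ?E = "cdf_of (Suc m) (rearranged (Suc m) e S \<mu>)"
  have sets: "sets \<mu> = sets (cube_borel n)" using \<mu> by (simp add: copula_measure_def)
  have e1: "(e \<circ> Suc) ` {1..m} \<subseteq> {1..n}"
    using e by (auto simp: image_subset_iff)
  have refl: "pull (Suc m) (reflection (Suc m) {1}) ?E = cdf_of (Suc m) (rearranged (Suc m) e S' \<mu>)"
    using S' by (intro pull_reflection_rearranged[OF \<mu> e]) auto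
  consider "m = 0" | "m = 1" | "m \<ge> 2" by linarith
  then show ?thesis
  proof cases
    case 1
    then show ?thesis
      using kappa_rearranged_less_2[OF \<mu>] e e1 by simp
  next
    case 2
    then have "kappa_rearranged \<mu> m (e \<circ> Suc) S = 0"
      using kappa_rearranged_less_2[OF \<mu> e1] by simp
    moreover have "copula_measure 2 (rearranged 2 e S \<mu>)"
      using copula_measure_rearranged[OF \<mu> e] 2 by (simp add: numeral_2_eq_2)
    from kappa_2_reflection[OF this]
    have "kappa_rearranged \<mu> (Suc m) e S + kappa_rearranged \<mu> (Suc m) e S' = 0"
      using refl 2 by (simp add: kappa_rearranged_def numeral_2_eq_2)
    ultimately show ?thesis by simp
  next
    case 3
    let ?y = "\<lambda>x. \<lambda>i\<in>{1..m + 1}. if i = 1 then 1 else x (i - 1)"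
    have "cdf_of m (rearranged m (e \<circ> Suc) S \<mu>) x = ?E (?y x)" if x: "x \<in> cube m" for x
    proof -
      have y: "?y x \<in> cube (Suc m)"
      proof -
        have "x (i - 1) \<in> {0..1}" if "i \<in> {1..m + 1}" "i \<noteq> 1" for i
          using x that by (auto simp: cube_def dest!: PiE_mem[of x _ _ "i - 1"])
        then show ?thesis by (auto simp: cube_def PiE_iff)
      qed
      \<comment> \<open>The bound at position 1 is 1 and hence void; the other bounds are shifted by
        one position.\<close>
      have "(\<forall>k\<in>{1..m}. rearrange m (e \<circ> Suc) S z k \<le> x k) \<longleftrightarrow>
          (\<forall>k\<in>{1..Suc m}. rearrange (Suc m) e S z k \<le> ?y x k)"
        if z: "z \<in> cube n" for z
      proof -
        have "rearrange (Suc m) e S z 1 \<le> 1"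
          using rearrange_in_cube[OF z e, of S] by (auto simp: cube_def PiE_iff)
        moreover have "{1..Suc m} = insert 1 (Suc ` {1..m})"
          by (auto simp: image_Suc_atLeastAtMost)
        then have "(\<forall>k\<in>{1..Suc m}. P k) \<longleftrightarrow> P 1 \<and> (\<forall>k\<in>{1..m}. P (Suc k))" for P
          by (simp del: image_Suc_atLeastAtMost)
        note this[of "\<lambda>k. rearrange (Suc m) e S z k \<le> ?y x k"]
        ultimately show ?thesis by (simp add: rearrange_def)
      qed
      then have "{z \<in> cube n. \<forall>k\<in>{1..m}. rearrange m (e \<circ> Suc) S z k \<le> x k} =
          {z \<in> cube n. \<forall>k\<in>{1..Suc m}. rearrange (Suc m) e S z k \<le> ?y x k}"
        by blast
      then show ?thesis
        using measure_rearranged_lower_box[OF sets e1 x]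
          measure_rearranged_lower_box[OF sets e y] x y
        by (simp add: cdf_of_def)
    qed
    then have "r m * \<kappa> m (cdf_of m (rearranged m (e \<circ> Suc) S \<mu>)) =
        \<kappa> (m + 1) ?E + \<kappa> (m + 1) (pull (m + 1) (reflection (m + 1) {1}) ?E)"
      using 3 copula_cdf_of[OF copula_measure_rearranged[OF \<mu> e1]]
        copula_cdf_of[OF copula_measure_rearranged[OF \<mu> e]]
      by (intro A7) simp_all
    then show ?thesis using refl by (simp add: kappa_rearranged_def)
  qed
qed

end

section \<open>Proper copulas of extended marginals\<close>

text \<open>The position grows strictly along the complement of \<open>T\<close> and stays between 1
  and the size of that complement, so counting turns injectivity into bijectivity.\<close>

lemma bij_betw_position:
  assumes "T \<subseteq> {1..n}"
  shows "bij_betw (\<lambda>i. card ({1..i} - T)) ({1..n} - T) {1..n - card T}"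
proof -
  let ?p = "\<lambda>i. card ({1..i} - T)"
  have less: "?p i < ?p j" if "i < j" "j \<in> {1..n} - T" for i j
  proof (rule psubset_card_mono)
    have "j \<in> {1..j} - T" "j \<notin> {1..i} - T" using that by auto
    moreover have "{1..i} - T \<subseteq> {1..j} - T" using that(1) by auto
    ultimately show "{1..i} - T \<subset> {1..j} - T" by blast
  qed simp
  have inj: "inj_on ?p ({1..n} - T)"
  proof (rule linorder_inj_onI)
    fix i j assume "i < j" "j \<in> {1..n} - T"
    from less[OF this] show "?p i \<noteq> ?p j" by simp
  qed auto
  have card: "card ({1..n} - T) = n - card T"
    using assms by (simp add: card_Diff_subset finite_subset)
  have "?p i \<in> {1..n - card T}" if "i \<in> {1..n} - T" for i
  proof -
    have "?p i \<le> card ({1..n} - T)" using that by (intro card_mono) auto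
    moreover have "i \<in> {1..i} - T" using that by simp
    then have "0 < ?p i" by (subst card_gt_0_iff) blast
    ultimately show ?thesis using card by simp
  qed
  then have "?p ` ({1..n} - T) = {1..n - card T}"
    using card card_image[OF inj] by (intro card_subset_eq) auto
  with inj show ?thesis by (simp add: bij_betw_def)
qed

text \<open>The increasing enumeration of \<open>{1..n} - T\<close>, written as the inverse of the
  position map that occurs in \<open>proper_copula\<close>.\<close>

definition remaining :: "nat \<Rightarrow> nat set \<Rightarrow> nat \<Rightarrow> nat" where
  "remaining n T = inv_into ({1..n} - T) (\<lambda>i. card ({1..i} - T))"

lemma bij_betw_remaining:
  "T \<subseteq> {1..n} \<Longrightarrow> bij_betw (remaining n T) {1..n - card T} ({1..n} - T)"
  unfolding remaining_def by (intro bij_betw_inv_into bij_betw_position)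

text \<open>A proper copula evaluates \<open>F\<close> only at points with value 1 on
  \<open>T\<close>, so \<open>F\<close> has to be known only there. At such points the inequalities
  in \<open>T\<close> are void and the others are renumbered by position.\<close>

lemma proper_copula_eq_cdf_of:
  assumes sets: "sets \<mu> = sets (cube_borel n)" and T: "T \<subseteq> {1..n}"
    and F: "\<And>x. \<lbrakk>x \<in> cube n; \<And>i. i \<in> T \<Longrightarrow> x i = 1\<rbrakk> \<Longrightarrow>
      F x = measure \<mu> {z \<in> cube n. \<forall>i\<in>{1..n}. rearrange n (\<lambda>k. k) S z i \<le> x i}"
  shows "proper_copula n T F =
    cdf_of (n - card T) (rearranged (n - card T) (remaining n T) S \<mu>)"
proof
  fix y :: "nat \<Rightarrow> real"
  let ?m = "n - card T" and ?p = "\<lambda>i. card ({1..i} - T)"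
  let ?x = "\<lambda>i\<in>{1..n}. if i \<in> T then 1 else y (?p i)"
  have im: "remaining n T ` {1..?m} \<subseteq> {1..n}"
    using bij_betw_remaining[OF T] by (auto simp: bij_betw_def)
  show "proper_copula n T F y = cdf_of ?m (rearranged ?m (remaining n T) S \<mu>) y"
  proof (cases "y \<in> cube ?m")
    case True
    have p: "?p i \<in> {1..?m}" "remaining n T (?p i) = i" if "i \<in> {1..n} - T" for i
      using bij_betwE[OF bij_betw_position[OF T]] bij_betw_inv_into_left[OF bij_betw_position[OF T]] that
      by (simp_all add: remaining_def del: atLeastAtMost_iff)
    have rem: "remaining n T k \<in> {1..n} - T" "?p (remaining n T k) = k" if "k \<in> {1..?m}" for k
      using bij_betwE[OF bij_betw_remaining[OF T]] bij_betw_inv_into_right[OF bij_betw_position[OF T]] that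
      by (simp_all add: remaining_def del: atLeastAtMost_iff)
    have x: "?x \<in> cube n"
      using True p(1) by (auto simp: cube_def PiE_iff Ball_def)
    have "(\<forall>i\<in>{1..n}. rearrange n (\<lambda>k. k) S z i \<le> ?x i) \<longleftrightarrow>
        (\<forall>k\<in>{1..?m}. rearrange ?m (remaining n T) S z k \<le> y k)" if z: "z \<in> cube n" for z
    proof -
      have "rearrange n (\<lambda>k. k) S z i \<le> 1" if "i \<in> {1..n}" for i
        using z that by (auto simp: rearrange_def cube_def PiE_iff)
      then have "(\<forall>i\<in>{1..n}. rearrange n (\<lambda>k. k) S z i \<le> ?x i) \<longleftrightarrow>
          (\<forall>i\<in>{1..n} - T. rearrange n (\<lambda>k. k) S z i \<le> y (?p i))"
        by auto
      also have "\<dots> \<longleftrightarrow> (\<forall>k\<in>{1..?m}. rearrange ?m (remaining n T) S z k \<le> y k)"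
      proof (intro iffI ballI)
        fix k assume *: "\<forall>i\<in>{1..n} - T. rearrange n (\<lambda>k. k) S z i \<le> y (?p i)" "k \<in> {1..?m}"
        show "rearrange ?m (remaining n T) S z k \<le> y k"
          using bspec[OF *(1) rem(1)[OF *(2)]] rem[OF *(2)] *(2) by (simp add: rearrange_def)
      next
        fix i assume *: "\<forall>k\<in>{1..?m}. rearrange ?m (remaining n T) S z k \<le> y k" "i \<in> {1..n} - T"
        show "rearrange n (\<lambda>k. k) S z i \<le> y (?p i)"
          using bspec[OF *(1) p(1)[OF *(2)]] p[OF *(2)] *(2)
          by (simp add: rearrange_def split: if_splits)
      qed
      finally show ?thesis .
    qed
    then have "{z \<in> cube n. \<forall>i\<in>{1..n}. rearrange n (\<lambda>k. k) S z i \<le> ?x i} =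
        {z \<in> cube n. \<forall>k\<in>{1..?m}. rearrange ?m (remaining n T) S z k \<le> y k}"
      by (intro Collect_cong conj_cong refl)
    moreover have "F ?x = measure \<mu> {z \<in> cube n. \<forall>i\<in>{1..n}. rearrange n (\<lambda>k. k) S z i \<le> ?x i}"
      using T by (intro F[OF x]) auto
    ultimately show ?thesis
      using True measure_rearranged_lower_box[OF sets im True]
      by (simp add: proper_copula_def cdf_of_def)
  qed (simp add: proper_copula_def cdf_of_def)
qed

lemma ext_marginal_apply:
  assumes "x \<in> cube n" "\<And>i. i \<in> T \<Longrightarrow> x i = 1"
  shows "ext_marginal n T F x = F x"
proof -
  have "(\<lambda>i\<in>{1..n}. if i \<in> T then 1 else x i) = x"
    using assms by (auto simp: cube_def fun_eq_iff PiE_iff extensional_def)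
  then show ?thesis using assms by (simp add: ext_marginal_def)
qed

text \<open>Here the reflection precedes the marginal, as in \<open>frakA\<close>. Empty
  \<open>S\<close> yields the unreflected marginals of the expansion.\<close>

lemma proper_copula_ext_marginal:
  assumes \<mu>: "copula_measure n \<mu>" and T: "T \<subseteq> {1..n}"
  shows "proper_copula n T (ext_marginal n T (pull n (reflection n S) (cdf_of n \<mu>))) =
    cdf_of (n - card T) (rearranged (n - card T) (remaining n T) S \<mu>)"
proof (rule proper_copula_eq_cdf_of)
  show sets: "sets \<mu> = sets (cube_borel n)" using \<mu> by (simp add: copula_measure_def)
  fix x :: "nat \<Rightarrow> real" assume x: "x \<in> cube n" "\<And>i. i \<in> T \<Longrightarrow> x i = 1"
  have "measure (rearranged n (\<lambda>k. k) S \<mu>) (lower_box n x) =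
      measure \<mu> {z \<in> cube n. \<forall>i\<in>{1..n}. rearrange n (\<lambda>k. k) S z i \<le> x i}"
    by (rule measure_rearranged_lower_box[OF sets _ x(1)]) simp
  then show "ext_marginal n T (pull n (reflection n S) (cdf_of n \<mu>)) x =
      measure \<mu> {z \<in> cube n. \<forall>i\<in>{1..n}. rearrange n (\<lambda>k. k) S z i \<le> x i}"
    using x by (simp add: ext_marginal_apply pull_reflection[OF copula_measure_represents[OF \<mu>]]
        cdf_of_def[of n "rearranged n (\<lambda>k. k) S \<mu>"])
qed (rule T)

text \<open>The measure of an extended marginal arises by moving all mass to the face where the
  coordinates in \<open>T\<close> vanish; every lower box contains 0 in each coordinate.\<close>

lemma proper_copula_pull_ext_marginal:
  assumes \<mu>: "copula_measure n \<mu>" and T: "T \<subseteq> {1..n}" and ST: "S \<inter> T = {}"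
  shows "proper_copula n T (pull n (reflection n S) (ext_marginal n T (cdf_of n \<mu>))) =
    cdf_of (n - card T) (rearranged (n - card T) (remaining n T) S \<mu>)"
proof (rule proper_copula_eq_cdf_of)
  interpret prob_space \<mu> using \<mu> by (simp add: copula_measure_def)
  show sets: "sets \<mu> = sets (cube_borel n)" using \<mu> by (simp add: copula_measure_def)
  note sp = sets_eq_imp_space_eq[OF sets]
  define Z :: "(nat \<Rightarrow> real) \<Rightarrow> nat \<Rightarrow> real" where
    "Z x = (\<lambda>i\<in>{1..n}. if i \<in> T then 0 else x i)" for x
  have "Z \<in> cube_borel n \<rightarrow>\<^sub>M cube_borel n"
    unfolding cube_borel_def Z_def
  proof (rule measurable_restrict)
    fix i assume i: "i \<in> {1..n}"
    show "(\<lambda>x. if i \<in> T then 0 else x i) \<in> (\<Pi>\<^sub>M i\<in>{1..n}. unit_borel) \<rightarrow>\<^sub>M unit_borel"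
      using measurable_component_singleton[OF i, of "\<lambda>_. unit_borel"]
      by (cases "i \<in> T") (simp_all add: measurable_const)
  qed
  then have Z: "Z \<in> \<mu> \<rightarrow>\<^sub>M cube_borel n"
    using measurable_cong_sets[OF sets refl] by blast
  have R: "rearrange n (\<lambda>k. k) S \<in> cube_borel n \<rightarrow>\<^sub>M cube_borel n"
    by (rule rearrange_measurable) simp
  let ?\<nu> = "distr \<mu> (cube_borel n) Z"
  have "represents n ?\<nu> (ext_marginal n T (cdf_of n \<mu>))"
    unfolding represents_def
  proof (intro conjI ballI)
    show "finite_measure ?\<nu>" using Z by (rule finite_measure_distr)
    fix x assume x: "x \<in> cube n"
    let ?x = "\<lambda>i\<in>{1..n}. if i \<in> T then 1 else x i"
    have "?x \<in> cube n" using x by (auto simp: cube_def PiE_iff)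
    moreover have "Z -` lower_box n x \<inter> cube n = lower_box n ?x"
      using x by (force simp: Z_def lower_box_def cube_def PiE_iff split: if_splits)
    ultimately show "measure ?\<nu> (lower_box n x) = ext_marginal n T (cdf_of n \<mu>) x"
      using x Z sp by (simp add: measure_distr lower_box_in_sets ext_marginal_def cdf_of_def)
  qed simp
  note pull = pull_reflection[OF this, of S]
  fix x :: "nat \<Rightarrow> real" assume x: "x \<in> cube n" "\<And>i. i \<in> T \<Longrightarrow> x i = 1"
  have "rearrange n (\<lambda>k. k) S (Z z) \<in> lower_box n x \<longleftrightarrow>
      (\<forall>i\<in>{1..n}. rearrange n (\<lambda>k. k) S z i \<le> x i)" if z: "z \<in> cube n" for z
  proof -
    \<comment> \<open>Since \<open>S\<close> avoids \<open>T\<close>, a coordinate in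
      \<open>T\<close> is still 0 after the reflection and meets the bound 1, as the corresponding
      coordinate of \<open>z\<close> does; outside \<open>T\<close> the map \<open>Z\<close> changes
      nothing.\<close>
    have "(0 \<le> rearrange n (\<lambda>k. k) S (Z z) i \<and> rearrange n (\<lambda>k. k) S (Z z) i \<le> x i) \<longleftrightarrow>
        rearrange n (\<lambda>k. k) S z i \<le> x i" if "i \<in> {1..n}" for i
      using z that x ST by (auto simp: rearrange_def Z_def cube_def PiE_iff)
    moreover have "rearrange n (\<lambda>k. k) S (Z z) \<in> extensional {1..n}"
      by (simp add: rearrange_def)
    ultimately show ?thesis
      by (simp add: lower_box_def PiE_iff)
  qed
  then have "(rearrange n (\<lambda>k. k) S \<circ> Z) -` lower_box n x \<inter> cube n =
      {z \<in> cube n. \<forall>i\<in>{1..n}. rearrange n (\<lambda>k. k) S z i \<le> x i}"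
    by auto
  moreover have "measure (rearranged n (\<lambda>k. k) S ?\<nu>) (lower_box n x) =
      measure \<mu> ((rearrange n (\<lambda>k. k) S \<circ> Z) -` lower_box n x \<inter> cube n)"
    unfolding rearranged_def distr_distr[OF R Z]
    using sp x measurable_comp[OF Z R] by (simp only: measure_distr lower_box_in_sets space_cube_borel)
  ultimately show "pull n (reflection n S) (ext_marginal n T (cdf_of n \<mu>)) x =
      measure \<mu> {z \<in> cube n. \<forall>i\<in>{1..n}. rearrange n (\<lambda>k. k) S z i \<le> x i}"
    using x by (simp add: pull cdf_of_def[of n "rearranged n (\<lambda>k. k) S ?\<nu>"])
qed (rule T)

section \<open>Solving the recursion by an alternating sum over subsets\<close>

text \<open>Induction on \<open>S\<close> for all \<open>T\<close> at once. Of the two terms of the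
  recursion, the one with \<open>insert i T\<close> yields the subsets containing \<open>i\<close>,
  the one with \<open>T\<close> those avoiding \<open>i\<close>. The leading factor
  \<open>r (n - card T)\<close> is what lets the products of \<open>r\<close> grow by one factor per
  step.\<close>

lemma alternating_sum_of_recursion:
  fixes K :: "'a set \<Rightarrow> 'a set \<Rightarrow> real" and r :: "nat \<Rightarrow> real"
  assumes V: "finite V" "card V = n"
    and K: "\<And>T S i. \<lbrakk>T \<subseteq> V; S \<subseteq> V; i \<in> V; i \<notin> T; i \<notin> S\<rbrakk> \<Longrightarrow>
      K T (insert i S) = r (n - Suc (card T)) * K (insert i T) S - K T S"
    and S: "S \<subseteq> V" and T: "T \<subseteq> V" "S \<inter> T = {}"
  shows "r (n - card T) * K T S =
    (\<Sum>P\<in>Pow S. (-1) ^ (card S - card P) * (\<Prod>i = n - card T - card P..n - card T. r i) * K (T \<union> P) {})"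
  using finite_subset[OF S V(1)] S T
proof (induction S arbitrary: T rule: finite_induct)
  case empty
  then show ?case by simp
next
  case (insert i S)
  let ?g = "\<lambda>T S P. (-1) ^ (card S - card P) * (\<Prod>j = n - card T - card P..n - card T. r j) * K (T \<union> P) {}"
  have finT: "finite T" using insert.prems V(1) by (auto intro: finite_subset)
  \<comment> \<open>As \<open>i\<close> lies outside \<open>T\<close>, there is room for one more
    element, and the subtractions below are not cut off at 0.\<close>
  have "card (insert i T) \<le> n"
    using insert.prems V by (metis card_mono insert_subset)
  then have "Suc (card T) \<le> n" using insert.prems finT by auto
  then obtain m where m: "n - card T = Suc m" "n - Suc (card T) = m"
    by (metis Suc_diff_le diff_Suc_Suc)
  have finP: "finite P" "card P \<le> card S" "i \<notin> P" if "P \<in> Pow S" for P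
    using that insert.hyps by (auto intro: finite_subset card_mono)
  have "r (n - card T) * K T (insert i S) =
      r (Suc m) * (r (n - card (insert i T)) * K (insert i T) S) - r (n - card T) * K T S"
  proof -
    have "K T (insert i S) = r (n - Suc (card T)) * K (insert i T) S - K T S"
      using insert.prems insert.hyps by (intro K) auto
    then show ?thesis using insert.prems finT m by (simp add: right_diff_distrib)
  qed
  also have "r (n - card (insert i T)) * K (insert i T) S = (\<Sum>P\<in>Pow S. ?g (insert i T) S P)"
    using insert.prems insert.hyps by (intro insert.IH) auto
  \<comment> \<open>The new factor extends the product at its upper end. The lower end and the sign
    stay, because \<open>i\<close> is added to both sets in each difference of
    cardinalities.\<close>
  also have "r (Suc m) * \<dots> = (\<Sum>P\<in>Pow S. ?g T (insert i S) (insert i P))"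
    unfolding sum_distrib_left
  proof (rule sum.cong[OF refl])
    fix P assume P: "P \<in> Pow S"
    have "insert i T \<union> P = T \<union> insert i P" by auto
    then show "r (Suc m) * ?g (insert i T) S P = ?g T (insert i S) (insert i P)"
      using insert.prems insert.hyps finT m finP[OF P]
      by (simp add: prod.cl_ivl_Suc algebra_simps)
  qed
  also have "r (n - card T) * K T S = (\<Sum>P\<in>Pow S. ?g T S P)"
    using insert.prems by (intro insert.IH) auto
  \<comment> \<open>The larger ambient set raises the exponent by one for subsets that avoid
    \<open>i\<close>.\<close>
  also have "\<dots> = - (\<Sum>P\<in>Pow S. ?g T (insert i S) P)"
    unfolding sum_negf[symmetric]
    by (rule sum.cong[OF refl]) (use finP insert.hyps in \<open>simp add: Suc_diff_le\<close>)
  also have "(\<Sum>P\<in>Pow S. ?g T (insert i S) (insert i P)) - - (\<Sum>P\<in>Pow S. ?g T (insert i S) P) =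
      (\<Sum>P\<in>Pow (insert i S). ?g T (insert i S) P)"
  proof -
    have "inj_on (insert i) (Pow S)" using insert.hyps by (auto simp: inj_on_def)
    moreover have "Pow S \<inter> insert i ` Pow S = {}" using insert.hyps by auto
    ultimately show ?thesis
      unfolding Pow_insert using insert.hyps
      by (simp add: sum.union_disjoint sum.reindex)
  qed
  finally show ?case .
qed

text \<open>Grouping by \<open>j = m - card P\<close> matches the summation index of the theorem;
  \<open>card S \<le> m\<close> makes \<open>j\<close> determine the cardinality.\<close>

lemma sum_Pow_by_card:
  fixes f :: "'a set \<Rightarrow> real"
  assumes "finite S" "card S \<le> m"
  shows "(\<Sum>P\<in>Pow S. f P) = (\<Sum>j = m - card S..m. \<Sum>P | P \<subseteq> S \<and> card P = m - j. f P)"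
proof -
  have le: "card P \<le> card S" if "P \<subseteq> S" for P using assms that by (simp add: card_mono)
  have "(\<Sum>P\<in>Pow S. f P) = (\<Sum>j = m - card S..m. sum f {P \<in> Pow S. m - card P = j})"
    using assms le by (intro sum.group[symmetric]) (auto intro!: diff_le_mono2)
  also have "\<dots> = (\<Sum>j = m - card S..m. \<Sum>P | P \<subseteq> S \<and> card P = m - j. f P)"
  proof (intro sum.cong refl)
    fix j assume "j \<in> {m - card S..m}"
    then have "m - card P = j \<longleftrightarrow> card P = m - j" if "P \<subseteq> S" for P
      using le[OF that] assms(2) by auto
    then show "{P \<in> Pow S. m - card P = j} = {P. P \<subseteq> S \<and> card P = m - j}" by auto
  qed
  finally show ?thesis .
qed

section \<open>Removing one reflection at an arbitrary coordinate\<close>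

text \<open>By permutation invariance the coordinates outside \<open>T\<close> may be listed with
  \<open>i\<close> in front, where A7 applies.\<close>

lemma (in measure_of_concordance) kappa_rearranged_recursion:
  assumes \<mu>: "copula_measure n \<mu>" and T: "T \<subseteq> {1..n}"
    and i: "i \<in> {1..n}" "i \<notin> T" "i \<notin> S"
  shows "kappa_rearranged \<mu> (n - card T) (remaining n T) (insert i S) =
    r (n - Suc (card T)) * kappa_rearranged \<mu> (n - card (insert i T)) (remaining n (insert i T)) S
    - kappa_rearranged \<mu> (n - card T) (remaining n T) S"
proof -
  have finT: "finite T" using T by (rule finite_subset) simp
  have iT: "insert i T \<subseteq> {1..n}" using T i by simp
  have "card (insert i T) \<le> card {1..n}" using iT by (rule card_mono[rotated]) simp
  moreover have card_iT: "card (insert i T) = Suc (card T)" using i finT by simp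
  moreover define m where "m = n - Suc (card T)"
  ultimately have m: "n - card T = Suc m" "n - Suc (card T) = m" "n - card (insert i T) = m"
    by (simp_all del: card_insert_disjoint)
  \<comment> \<open>First \<open>i\<close>, then the coordinates outside \<open>insert i T\<close>
    in increasing order, so that \<open>e \<circ> Suc\<close> is the enumeration for the smaller
    marginal.\<close>
  define e where "e k = (if k = 1 then i else remaining n (insert i T) (k - 1))" for k
  have rem: "bij_betw (remaining n (insert i T)) {1..m} ({1..n} - insert i T)"
    using bij_betw_remaining[OF iT] m by simp
  have e: "bij_betw e {1..Suc m} ({1..n} - T)"
  proof -
    have "bij_betw (\<lambda>k. k - 1) {2..Suc m} {1..m}"
      by (rule bij_betw_byWitness[where f'=Suc]) auto
    from bij_betw_trans[OF this rem]
    have "bij_betw e {2..Suc m} ({1..n} - insert i T)"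
      by (rule iffD1[OF bij_betw_cong, rotated]) (auto simp: e_def)
    moreover have "bij_betw e {1} {i}" by (simp add: e_def)
    ultimately have "bij_betw e ({1} \<union> {2..Suc m}) ({i} \<union> ({1..n} - insert i T))"
      by (intro bij_betw_combine) auto
    moreover have "{1} \<union> {2..Suc m} = {1..Suc m}" by auto
    moreover have "{i} \<union> ({1..n} - insert i T) = {1..n} - T" using i by auto
    ultimately show ?thesis by simp
  qed
  have eq: "kappa_rearranged \<mu> (n - card T) (remaining n T) S' = kappa_rearranged \<mu> (Suc m) e S'" for S'
    using kappa_rearranged_image_cong[OF \<mu> _ _ e] bij_betw_remaining[OF T] m by simp
  \<comment> \<open>Only position 1 reads coordinate \<open>i\<close>, hence adding \<open>i\<close>
    to \<open>S\<close> toggles the reflection there and nowhere else.\<close>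
  have inj: "e k = i \<longleftrightarrow> k = 1" if "k \<in> {1..Suc m}" for k
  proof -
    have "e 1 = i" by (simp add: e_def)
    then show ?thesis
      using inj_on_eq_iff[OF bij_betw_imp_inj_on[OF e] that, of 1] by simp
  qed
  have "r m * kappa_rearranged \<mu> m (e \<circ> Suc) S =
      kappa_rearranged \<mu> (Suc m) e S + kappa_rearranged \<mu> (Suc m) e (insert i S)"
  proof (rule kappa_rearranged_A7[OF \<mu>])
    show "e ` {1..Suc m} \<subseteq> {1..n}" using e by (auto simp: bij_betw_def)
    fix k assume "k \<in> {1..Suc m}"
    then show "e k \<in> insert i S \<longleftrightarrow> (e k \<in> S) \<noteq> (k = 1)"
      using inj[of k] i by (cases "k = 1") auto
  qed
  moreover have "kappa_rearranged \<mu> m (e \<circ> Suc) S =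
      kappa_rearranged \<mu> m (remaining n (insert i T)) S"
    by (rule kappa_rearranged_cong[OF \<mu>]) (auto simp: e_def)
  ultimately show ?thesis using eq m by simp
qed

section \<open>The expansion sorted by cardinality, in both notations\<close>

theorem theorem4:
  fixes \<kappa> :: "nat \<Rightarrow> ((nat \<Rightarrow> real) \<Rightarrow> real) \<Rightarrow> real"
    and r :: "nat \<Rightarrow> real"
    and n s t :: nat
    and C :: "(nat \<Rightarrow> real) \<Rightarrow> real"
    and S T :: "nat set"
  assumes "measure_of_concordance \<kappa> r"
    and "copula n C"
    and "S \<subseteq> {1..n}" and "T \<subseteq> {1..n}" and "S \<inter> T = {}"
    and "s = card S" and "t = card T"
  shows "r (n - t) * \<kappa> (n - t) (proper_copula n T (pull n (reflection n S) (ext_marginal n T C))) =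
      (\<Sum>j = n - t - s..n - t. (-1) ^ (n - t - s + j) * (\<Prod>i = j..n - t. r i) *
        (\<Sum>P | P \<subseteq> S \<and> card P = n - t - j.
           \<kappa> j (proper_copula n (T \<union> P) (ext_marginal n (T \<union> P) C))))
    \<and> frakA \<kappa> r n {1..n} (n - t) T (pull n (reflection n S) C) =
      (\<Sum>j = n - t - s..n - t. (-1) ^ (n - t - s + j) * frakA \<kappa> r n S j T C)"
proof -
  interpret measure_of_concordance \<kappa> r by fact
  from assms(2) obtain \<mu> where \<mu>: "copula_measure n \<mu>" and C: "C = cdf_of n \<mu>"
    by (rule copulaE)
  have sets: "sets \<mu> = sets (cube_borel n)" using \<mu> by (simp add: copula_measure_def)
  \<comment> \<open>Writing \<open>C\<close> as its own pullback along the empty reflection makes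
    the marginals of \<open>C\<close> a case of \<open>proper_copula_ext_marginal\<close>.\<close>
  have pull_id: "pull n (reflection n {}) C = C"
    unfolding C pull_reflection[OF copula_measure_represents[OF \<mu>]] rearranged_id[OF sets] ..
  define K where "K T S = kappa_rearranged \<mu> (n - card T) (remaining n T) S" for T S
  have finS: "finite S" and finT: "finite T" using assms(3,4) by (auto intro: finite_subset)
  \<comment> \<open>This keeps every natural-number subtraction in the statement exact over the
    range of \<open>j\<close>.\<close>
  have card_ST: "s + t \<le> n"
    using card_mono[of "{1..n}" "S \<union> T"] assms(3-7) finS finT by (simp add: card_Un_disjoint)
  have KTS: "\<kappa> (n - t) (proper_copula n T (pull n (reflection n S) (ext_marginal n T C))) = K T S"
    unfolding C K_def kappa_rearranged_def
      proper_copula_pull_ext_marginal[OF \<mu> assms(4,5)] assms(7) ..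
  have KTS': "\<kappa> (n - t) (proper_copula n T (ext_marginal n T (pull n (reflection n S) C))) = K T S"
    unfolding C K_def kappa_rearranged_def
      proper_copula_ext_marginal[OF \<mu> assms(4)] assms(7) ..
  have marg: "\<kappa> j (proper_copula n (T \<union> P) (ext_marginal n (T \<union> P) C)) = K (T \<union> P) {}"
    if "P \<subseteq> S" "card P = n - t - j" "j \<le> n - t" for P j
  proof -
    have P: "T \<union> P \<subseteq> {1..n}" "finite P" "T \<inter> P = {}"
      using that assms(3-5) finS by (auto intro: finite_subset)
    have "n - card (T \<union> P) = j"
      using P finT assms(7) that card_ST by (simp add: card_Un_disjoint)
    then show ?thesis
      using proper_copula_ext_marginal[OF \<mu> P(1), of "{}"] pull_id
      by (simp add: K_def kappa_rearranged_def C)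
  qed
  \<comment> \<open>The summand of the first form, to which that of the second form is reduced as
    well.\<close>
  define A where "A j = (-1) ^ (n - t - s + j) * (\<Prod>i = j..n - t. r i) *
    (\<Sum>P | P \<subseteq> S \<and> card P = n - t - j.
      \<kappa> j (proper_copula n (T \<union> P) (ext_marginal n (T \<union> P) C)))" for j
  have "r (n - t) * K T S =
      (\<Sum>P\<in>Pow S. (-1) ^ (s - card P) * (\<Prod>i = n - t - card P..n - t. r i) * K (T \<union> P) {})"
    unfolding assms(6,7)
  proof (rule alternating_sum_of_recursion[where V="{1..n}"])
    fix T S i assume "T \<subseteq> {1..n}" "i \<in> {1..n}" "i \<notin> T" "i \<notin> S"
    then show "K T (insert i S) = r (n - Suc (card T)) * K (insert i T) S - K T S"
      unfolding K_def by (rule kappa_rearranged_recursion[OF \<mu>])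
  qed (use assms(3-5) in simp_all)
  also have "\<dots> = (\<Sum>j = n - t - s..n - t. \<Sum>P | P \<subseteq> S \<and> card P = n - t - j.
      (-1) ^ (s - card P) * (\<Prod>i = n - t - card P..n - t. r i) * K (T \<union> P) {})"
    using sum_Pow_by_card[OF finS, of "n - t"] card_ST assms(6) by simp
  also have "\<dots> = (\<Sum>j = n - t - s..n - t. A j)"
    unfolding A_def sum_distrib_left
  proof (intro sum.cong refl)
    fix j P assume j: "j \<in> {n - t - s..n - t}" and P: "P \<in> {P. P \<subseteq> S \<and> card P = n - t - j}"
    \<comment> \<open>The two exponents differ by an even number, so the signs agree.\<close>
    have "n - t - s + j = s - card P + 2 * (n - t - s)"
      using j P card_ST by auto
    then have "(-1 :: real) ^ (s - card P) = (-1) ^ (n - t - s + j)"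
      by (simp add: power_add)
    moreover have "n - t - card P = j" using j P by auto
    ultimately show "(-1) ^ (s - card P) * (\<Prod>i = n - t - card P..n - t. r i) * K (T \<union> P) {} =
        (-1) ^ (n - t - s + j) * (\<Prod>i = j..n - t. r i) *
        \<kappa> j (proper_copula n (T \<union> P) (ext_marginal n (T \<union> P) C))"
      using marg[of P j] j P by simp
  qed
  finally have main: "r (n - t) * K T S = (\<Sum>j = n - t - s..n - t. A j)" .
  \<comment> \<open>At the top index only the empty set qualifies and the product has the single
    factor \<open>r (n - t)\<close>.\<close>
  have "{R. R \<subseteq> {1..n} - T \<and> card R + (n - t) + card T = n} = {{}}"
    using card_ST assms(7) by (auto simp: card_eq_0_iff dest: finite_subset)
  then have left: "frakA \<kappa> r n {1..n} (n - t) T (pull n (reflection n S) C) = r (n - t) * K T S"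
    using KTS' assms(7) by (simp add: frakA_def)
  have right: "(-1) ^ (n - t - s + j) * frakA \<kappa> r n S j T C = A j" if j: "j \<in> {n - t - s..n - t}" for j
  proof -
    have "{R. R \<subseteq> S - T \<and> card R + j + card T = n} = {P. P \<subseteq> S \<and> card P = n - t - j}"
      using j assms(5,7) card_ST by auto
    then show ?thesis
      by (simp add: frakA_def A_def assms(7) Un_commute)
  qed
  show ?thesis
  proof
    show "frakA \<kappa> r n {1..n} (n - t) T (pull n (reflection n S) C) =
        (\<Sum>j = n - t - s..n - t. (-1) ^ (n - t - s + j) * frakA \<kappa> r n S j T C)"
      unfolding left main by (rule sum.cong) (simp_all only: right)
  qed (use main in \<open>simp only: KTS A_def\<close>)
qed

end
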